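(* For every belief formula $\alpha$: $\mathtt b\mathsf{BD}\vdash\alpha$ if and only if $\alpha$ is valid (i.e. satisfied in every model $\mathscr M=\langle\mathcal A,v,\mathtt{bel}_1,\mathtt{bel}_2\rangle$).
   Context: Fix a finite set $\mathtt{Prop}$; $\mathscr{L}_{\mathsf{BD}}$ is the set of formulas over $\mathtt{Prop}$ with $\neg,\wedge,\vee$, and $\vdash_{\mathsf{BD}}$ is Belnap–Dunn (first-degree) entailment. A general belief function on a lattice $L$ is a monotone $b:L\to[0,1]$ with $b(\bigvee_{i=1}^ka_i)\ge\sum_{\varnothing\ne J\subseteq\{1..k\}}(-1)^{|J|+1}b(\bigwedge_{j\in J}a_j)$ for all $k\ge1$, $a_i\in L$. A primitive belief formula is $\sum_{i=1}^na_i\cdot\mathtt b^{\pm}(\phi_i)\ge c$ with $a_i,c\in\mathbb Z$, $\phi_i\in\mathscr{L}_{\mathsf{BD}}$, each term carrying $\mathtt b^+$ or $\mathtt b^-$; belief formulas are Boolean combinations (with $\sim,\wedge$ and classically defined connectives) of these. A model $\mathscr M=\langle\mathcal A,v,\mathtt{bel}_1,\mathtt{bel}_2\rangle$ consists of a De Morgan algebra $\mathcal A$, a homomorphic interpretation $v$ of $\mathscr{L}_{\mathsf{BD}}$ in $\mathcal A$, and general belief functions $\mathtt{bel}_1,\mathtt{bel}_2$ on $\mathcal A$ with $\mathtt{bel}_1(x)=\mathtt{bel}_2(\neg x)$ and $\mathtt{bel}_2(x)=\mathtt{bel}_1(\neg x)$ for all $x$. Satisfaction: a primitive belief formula holds iff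 $\sum a_i\cdot e_i\ge c$, where $e_i=\mathtt{bel}_1(v(\phi_i))$ for terms $\mathtt b^+(\phi_i)$ and $e_i=\mathtt{bel}_2(v(\phi_i))$ for terms $\mathtt b^-(\phi_i)$; $\sim,\wedge$ classical. The calculus $\mathtt b\mathsf{BD}$ has: substitution instances of classical tautologies; modus ponens; all instances of valid formulas about linear inequalities over the reals; B1: $\mathtt b^\pm(\phi)\ge0$, $\mathtt b^\pm(\phi)\le1$; B2: $\mathtt b^\mp(\phi)=\mathtt b^\pm(\neg\phi)$; B3: $\mathtt b^+(\bigvee_{i=1}^k\phi_i)\ge\sum_{\varnothing\ne J\subseteq\{1..k\}}(-1)^{|J|+1}\mathtt b^+(\bigwedge_{j\in J}\phi_j)$; B4: $\mathtt b^+(\phi)\le\mathtt b^+(\phi')$ and $\mathtt b^-(\phi)\ge\mathtt b^-(\phi')$ whenever $\phi\vdash_{\mathsf{BD}}\phi'$.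
   Formalization: In models, bel₂ is a general belief function for the dual order of the algebra, not the order itself: read literally, bel₁ and bel₂ would be equal constants, so b⁺(p) − b⁺(¬p) ≥ 0 would be valid yet underivable. *)

theory Defs
  imports Complex_Main "HOL-Algebra.Lattice" "HOL-Library.Infinite_Typeclass"
begin

section \<open>Belnap--Dunn logic\<close>

datatype 'p bd = Atom 'p | Neg "'p bd" | Conj "'p bd" "'p bd" | Disj "'p bd" "'p bd"

text \<open>A four-valued valuation consists of two independent sets of atoms: those supported as
  true and those supported as false.\<close>

fun bd_true :: "'p set \<Rightarrow> 'p set \<Rightarrow> 'p bd \<Rightarrow> bool"
  and bd_false :: "'p set \<Rightarrow> 'p set \<Rightarrow> 'p bd \<Rightarrow> bool" where
  "bd_true T F (Atom p) \<longleftrightarrow> p \<in> T"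
| "bd_true T F (Neg \<phi>) \<longleftrightarrow> bd_false T F \<phi>"
| "bd_true T F (Conj \<phi> \<psi>) \<longleftrightarrow> bd_true T F \<phi> \<and> bd_true T F \<psi>"
| "bd_true T F (Disj \<phi> \<psi>) \<longleftrightarrow> bd_true T F \<phi> \<or> bd_true T F \<psi>"
| "bd_false T F (Atom p) \<longleftrightarrow> p \<in> F"
| "bd_false T F (Neg \<phi>) \<longleftrightarrow> bd_true T F \<phi>"
| "bd_false T F (Conj \<phi> \<psi>) \<longleftrightarrow> bd_false T F \<phi> \<or> bd_false T F \<psi>"
| "bd_false T F (Disj \<phi> \<psi>) \<longleftrightarrow> bd_false T F \<phi> \<and> bd_false T F \<psi>"

definition bd_entails :: "'p bd \<Rightarrow> 'p bd \<Rightarrow> bool"  (infix \<open>\<turnstile>\<^sub>B\<^sub>D\<close> 50) where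
  "\<phi> \<turnstile>\<^sub>B\<^sub>D \<psi> \<longleftrightarrow> (\<forall>T F. bd_true T F \<phi> \<longrightarrow> bd_true T F \<psi>)"

text \<open>Iterated connectives; only used on nonempty lists.\<close>

definition big_disj :: "'p bd list \<Rightarrow> 'p bd" where
  "big_disj \<phi>s = foldl Disj (hd \<phi>s) (tl \<phi>s)"

definition big_conj :: "'p bd list \<Rightarrow> 'p bd" where
  "big_conj \<phi>s = foldl Conj (hd \<phi>s) (tl \<phi>s)"


section \<open>Belief formulas\<close>

text \<open>Boolean combinations are parametric in their primitive formulas: with primitives of type
  \<open>nat\<close> they are classical propositional formulas, with inequalities over \<open>nat\<close> they are
  formulas about linear inequalities, and with inequalities over \<open>'p bterm\<close> they are
  belief formulas.\<close>

datatype 'a bform = Prim 'a | Not "'a bform" | And "'a bform" "'a bform"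

definition Imp :: "'a bform \<Rightarrow> 'a bform \<Rightarrow> 'a bform" where
  "Imp \<alpha> \<beta> = Not (And \<alpha> (Not \<beta>))"

primrec bval :: "('a \<Rightarrow> bool) \<Rightarrow> 'a bform \<Rightarrow> bool" where
  "bval I (Prim a) \<longleftrightarrow> I a"
| "bval I (Not \<alpha>) \<longleftrightarrow> \<not> bval I \<alpha>"
| "bval I (And \<alpha> \<beta>) \<longleftrightarrow> bval I \<alpha> \<and> bval I \<beta>"

primrec subst :: "('a \<Rightarrow> 'b bform) \<Rightarrow> 'a bform \<Rightarrow> 'b bform" where
  "subst \<sigma> (Prim a) = \<sigma> a"
| "subst \<sigma> (Not \<alpha>) = Not (subst \<sigma> \<alpha>)"
| "subst \<sigma> (And \<alpha> \<beta>) = And (subst \<sigma> \<alpha>) (subst \<sigma> \<beta>)"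

text \<open>\<open>Ge [(a\<^sub>1, x\<^sub>1), \<dots>, (a\<^sub>n, x\<^sub>n)] c\<close> stands for \<open>a\<^sub>1 x\<^sub>1 + \<dots> + a\<^sub>n x\<^sub>n \<ge> c\<close>.\<close>

datatype 'x ineq = Ge "(int \<times> 'x) list" int

primrec ineq_holds :: "('x \<Rightarrow> real) \<Rightarrow> 'x ineq \<Rightarrow> bool" where
  "ineq_holds e (Ge ts c) \<longleftrightarrow> (\<Sum>(a, x)\<leftarrow>ts. real_of_int a * e x) \<ge> real_of_int c"

datatype 'p bterm = BPlus "'p bd" | BMinus "'p bd"

type_synonym 'p belief_formula = "'p bterm ineq bform"


section \<open>Models\<close>

record 'a de_morgan = "'a gorder" +
  neg :: "'a \<Rightarrow> 'a"

locale de_morgan_algebra = bounded_lattice A for A :: "('a, 'b) de_morgan_scheme" (structure) +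
  assumes meet_join_distrib:
      "\<lbrakk>x \<in> carrier A; y \<in> carrier A; z \<in> carrier A\<rbrakk>
        \<Longrightarrow> x \<sqinter> (y \<squnion> z) = (x \<sqinter> y) \<squnion> (x \<sqinter> z)"
    and neg_closed: "x \<in> carrier A \<Longrightarrow> neg A x \<in> carrier A"
    and neg_neg: "x \<in> carrier A \<Longrightarrow> neg A (neg A x) = x"
    and neg_join:
      "\<lbrakk>x \<in> carrier A; y \<in> carrier A\<rbrakk> \<Longrightarrow> neg A (x \<squnion> y) = neg A x \<sqinter> neg A y"

definition general_belief :: "('a, 'b) gorder_scheme \<Rightarrow> ('a \<Rightarrow> real) \<Rightarrow> bool" where
  "general_belief L b \<longleftrightarrow>
     (\<forall>x \<in> carrier L. 0 \<le> b x \<and> b x \<le> 1) \<and>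
     (\<forall>x \<in> carrier L. \<forall>y \<in> carrier L. x \<sqsubseteq>\<^bsub>L\<^esub> y \<longrightarrow> b x \<le> b y) \<and>
     (\<forall>k \<ge> 1. \<forall>a :: nat \<Rightarrow> 'a. a ` {1..k} \<subseteq> carrier L \<longrightarrow>
        b (\<Squnion>\<^bsub>L\<^esub> (a ` {1..k})) \<ge>
          (\<Sum>J | J \<subseteq> {1..k} \<and> J \<noteq> {}. (- 1) ^ (card J + 1) * b (\<Sqinter>\<^bsub>L\<^esub> (a ` J))))"

text \<open>
  The negative belief \<open>bel\<^sub>2\<close> is a general belief function with respect to the dual of the
  order of \<open>A\<close>.  This is the order for which \<open>bel\<^sub>2 = bel\<^sub>1 \<circ> \<not>\<close> inherits the property from
  \<open>bel\<^sub>1\<close> (negation being an isomorphism from \<open>A\<close> onto its dual), and it matches axiom B4,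
  in which \<open>b\<^sup>-\<close> is antitone.  Demanding it for the order of \<open>A\<close> itself would leave only
  constant functions, see the lemma \<open>constant_if_both_general_belief\<close> below.
\<close>

locale belief_model = de_morgan_algebra A for A :: "('a, 'b) de_morgan_scheme" (structure) +
  fixes v :: "'p bd \<Rightarrow> 'a" and bel1 bel2 :: "'a \<Rightarrow> real"
  assumes v_closed: "v \<phi> \<in> carrier A"
    and v_Neg: "v (Neg \<phi>) = neg A (v \<phi>)"
    and v_Conj: "v (Conj \<phi> \<psi>) = v \<phi> \<sqinter> v \<psi>"
    and v_Disj: "v (Disj \<phi> \<psi>) = v \<phi> \<squnion> v \<psi>"
    and bel1: "general_belief A bel1"
    and bel2: "general_belief (inv_gorder A) bel2"
    and bel1_neg: "x \<in> carrier A \<Longrightarrow> bel1 x = bel2 (neg A x)"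
    and bel2_neg: "x \<in> carrier A \<Longrightarrow> bel2 x = bel1 (neg A x)"

primrec bterm_value :: "('p bd \<Rightarrow> 'a) \<Rightarrow> ('a \<Rightarrow> real) \<Rightarrow> ('a \<Rightarrow> real) \<Rightarrow> 'p bterm \<Rightarrow> real" where
  "bterm_value v bel1 bel2 (BPlus \<phi>) = bel1 (v \<phi>)"
| "bterm_value v bel1 bel2 (BMinus \<phi>) = bel2 (v \<phi>)"

definition satisfies ::
    "('p bd \<Rightarrow> 'a) \<Rightarrow> ('a \<Rightarrow> real) \<Rightarrow> ('a \<Rightarrow> real) \<Rightarrow> 'p belief_formula \<Rightarrow> bool" where
  "satisfies v bel1 bel2 \<alpha> \<longleftrightarrow> bval (ineq_holds (bterm_value v bel1 bel2)) \<alpha>"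

text \<open>HOL cannot quantify over types inside a formula, so validity is relative to the type
  \<open>'m\<close> whose subsets (finite ones included) are the carriers.  Every De Morgan algebra is
  isomorphic to one carried by a subset of an infinite type, so that validity in every model is
  validity for all infinite \<open>'m\<close>.\<close>

definition valid :: "'m itself \<Rightarrow> 'p belief_formula \<Rightarrow> bool" where
  "valid _ \<alpha> \<longleftrightarrow>
     (\<forall>(A :: 'm de_morgan) v bel1 bel2. belief_model A v bel1 bel2 \<longrightarrow> satisfies v bel1 bel2 \<alpha>)"

lemma (in de_morgan_algebra) constant_if_both_general_belief:
  assumes "general_belief A b1" "general_belief A b2"
    and b2: "\<And>x. x \<in> carrier A \<Longrightarrow> b2 x = b1 (neg A x)"
    and x: "x \<in> carrier A" and y: "y \<in> carrier A"
  shows "b1 x = b1 y"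
proof -
  have mono: "b z \<le> b w"
    if "general_belief A b" "z \<in> carrier A" "w \<in> carrier A" "z \<sqsubseteq> w" for b z w
    using that unfolding general_belief_def by blast
  have anti: "b1 w \<le> b1 z" if z: "z \<in> carrier A" and w: "w \<in> carrier A" and le: "z \<sqsubseteq> w" for z w
  proof -
    have "z \<squnion> w = w"
      using le le_iff_meet[OF z w] unfolding eq_is_equal by (rule iffD1[rotated])
    then have "neg A z \<sqinter> neg A w = neg A w"
      using neg_join[OF z w] by metis
    then have "neg A w \<sqsubseteq> neg A z"
      using meet_left[OF neg_closed[OF z] neg_closed[OF w]] by metis
    then have "b2 (neg A w) \<le> b2 (neg A z)"
      by (rule mono[OF assms(2) neg_closed[OF w] neg_closed[OF z]])
    then show ?thesis
      by (simp only: b2[OF neg_closed[OF z]] b2[OF neg_closed[OF w]] neg_neg[OF z] neg_neg[OF w])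
  qed
  have eq: "b1 z = b1 (x \<squnion> y)" if z: "z \<in> carrier A" and le: "z \<sqsubseteq> x \<squnion> y" for z
    using mono[OF assms(1) z join_closed[OF x y] le] anti[OF z join_closed[OF x y] le]
    by (rule order_antisym)
  show ?thesis
    using eq[OF x join_left[OF x y]] eq[OF y join_right[OF x y]] by simp
qed


section \<open>The calculus\<close>

text \<open>In B3, the subsets \<open>J\<close> of the index set correspond to the members of
  \<open>subseqs \<phi>s\<close> by position, with multiplicity if \<open>\<phi>s\<close> contains repetitions.  All terms are
  moved to the left-hand side of \<open>\<ge>\<close>, which turns the sign \<open>(-1)\<^bsup>|J|+1\<^esup>\<close> into \<open>(-1)\<^bsup>|J|\<^esup>\<close>.\<close>

inductive bBD_derivable :: "'p belief_formula \<Rightarrow> bool" where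
  taut: "(\<And>I. bval I (\<tau> :: nat bform)) \<Longrightarrow> bBD_derivable (subst \<sigma> \<tau>)"
| lin: "(\<And>e. bval (ineq_holds e) (\<gamma> :: nat ineq bform)) \<Longrightarrow>
    bBD_derivable (map_bform (map_ineq \<sigma>) \<gamma>)"
| mp: "bBD_derivable \<alpha> \<Longrightarrow> bBD_derivable (Imp \<alpha> \<beta>) \<Longrightarrow> bBD_derivable \<beta>"
| B1_lower_plus: "bBD_derivable (Prim (Ge [(1, BPlus \<phi>)] 0))"
| B1_lower_minus: "bBD_derivable (Prim (Ge [(1, BMinus \<phi>)] 0))"
| B1_upper_plus: "bBD_derivable (Prim (Ge [(-1, BPlus \<phi>)] (-1)))"
| B1_upper_minus: "bBD_derivable (Prim (Ge [(-1, BMinus \<phi>)] (-1)))"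
| B2_minus: "bBD_derivable (And (Prim (Ge [(1, BMinus \<phi>), (-1, BPlus (Neg \<phi>))] 0))
                   (Prim (Ge [(1, BPlus (Neg \<phi>)), (-1, BMinus \<phi>)] 0)))"
| B2_plus: "bBD_derivable (And (Prim (Ge [(1, BPlus \<phi>), (-1, BMinus (Neg \<phi>))] 0))
                  (Prim (Ge [(1, BMinus (Neg \<phi>)), (-1, BPlus \<phi>)] 0)))"
| B3: "\<phi>s \<noteq> [] \<Longrightarrow>
    bBD_derivable (Prim (Ge ((1, BPlus (big_disj \<phi>s)) #
                [((-1) ^ length \<psi>s, BPlus (big_conj \<psi>s)). \<psi>s \<leftarrow> subseqs \<phi>s, \<psi>s \<noteq> []]) 0))"
| B4_plus: "\<phi> \<turnstile>\<^sub>B\<^sub>D \<phi>' \<Longrightarrow> bBD_derivable (Prim (Ge [(1, BPlus \<phi>'), (-1, BPlus \<phi>)] 0))"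
| B4_minus: "\<phi> \<turnstile>\<^sub>B\<^sub>D \<phi>' \<Longrightarrow> bBD_derivable (Prim (Ge [(1, BMinus \<phi>), (-1, BMinus \<phi>')] 0))"

end

theory Submission
  imports Defs "HOL-Library.Countable"
begin

text \<open>
  Soundness of B4 needs \<open>v \<phi> \<sqsubseteq> v \<psi>\<close> for \<open>\<phi> \<turnstile>\<^sub>B\<^sub>D \<psi>\<close>.  An element \<open>z\<close> of a De Morgan algebra
  induces the four-valued valuation supporting the literals above \<open>z\<close>; if it makes \<open>\<phi>\<close> true then
  \<open>z \<sqsubseteq> v \<phi>\<close>, and by distributivity \<open>v \<phi>\<close> is the join of all such \<open>z\<close>.

  For completeness, formulas are identified with their sets of satisfying valuations.  As there are
  finitely many atoms, these form a finite De Morgan algebra of sets, which embeds into every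
  infinite type.  Inclusion--exclusion sums do not change when repetitions are dropped from the
  family, so finitely many instances of the axioms already force an assignment of reals to the
  belief terms to come from a belief function on this algebra.  If \<open>\<alpha>\<close> is valid, it is thus a
  linear consequence of finitely many axioms, hence derivable.
\<close>

section \<open>Sums over subsequences\<close>

text \<open>On a distinct list, \<open>set\<close> maps the subsequences bijectively onto the power
  set and turns length into cardinality.\<close>

lemma sum_list_subseqs_distinct:
  assumes "distinct xs"
  shows "(\<Sum>zs\<leftarrow>subseqs xs. f (length zs) (set zs)) = (\<Sum>J\<in>Pow (set xs). f (card J) J)"
proof -
  have "(\<Sum>zs\<leftarrow>subseqs xs. f (length zs) (set zs)) =
      (\<Sum>J\<leftarrow>map set (subseqs xs). f (card J) J)"
    unfolding map_map comp_def
    by (rule arg_cong[where f = sum_list], rule map_cong)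
      (use assms in \<open>auto simp: distinct_card dest: subseqs_distinctD\<close>)
  also have "\<dots> = (\<Sum>J\<in>set (map set (subseqs xs)). f (card J) J)"
    by (rule sum_list_distinct_conv_sum_set[OF distinct_set_subseqs[OF assms]])
  finally show ?thesis
    by (simp add: subseqs_powset)
qed

lemma subseqs_map: "subseqs (map f xs) = map (map f) (subseqs xs)"
  by (induction xs) (auto simp: Let_def)

text \<open>Links the positional form of B3 to the index sets in \<open>general_belief\<close>. The
  sum is moved to the list of indices, which is distinct even if \<open>a\<close> repeats values;
  the assumption on \<open>f\<close> disposes of the empty index set.\<close>

lemma sum_list_subseqs_map:
  fixes f :: "nat \<Rightarrow> 'a set \<Rightarrow> real"
  assumes "f 0 {} = 0"
  shows "(\<Sum>zs\<leftarrow>subseqs (map a [1..<Suc k]). f (length zs) (set zs)) =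
    (\<Sum>J | J \<subseteq> {1..k} \<and> J \<noteq> {}. f (card J) (a ` J))"
proof -
  have "(\<Sum>zs\<leftarrow>subseqs (map a [1..<Suc k]). f (length zs) (set zs)) =
      (\<Sum>zs\<leftarrow>subseqs [1..<Suc k]. f (length zs) (a ` set zs))"
    by (simp add: subseqs_map comp_def del: upt_Suc)
  also have "\<dots> = (\<Sum>J\<in>Pow (set [1..<Suc k]). f (card J) (a ` J))"
    by (rule sum_list_subseqs_distinct[where f = "\<lambda>n J. f n (a ` J)"]) simp
  also have "set [1..<Suc k] = {1..k}"
    by auto
  also have "(\<Sum>J\<in>Pow {1..k}. f (card J) (a ` J)) =
      (\<Sum>J | J \<subseteq> {1..k} \<and> J \<noteq> {}. f (card J) (a ` J))"
    by (rule sum.mono_neutral_right) (use assms in auto)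
  finally show ?thesis .
qed

text \<open>Evaluates the filtered list comprehension of B3, which unfolds to this
  \<open>concat\<close>.\<close>

lemma sum_list_concat_if:
  fixes h :: "'b \<Rightarrow> real"
  shows "(\<Sum>x\<leftarrow>concat (map (\<lambda>y. if P y then [g y] else []) ys). h x) =
    (\<Sum>y\<leftarrow>ys. if P y then h (g y) else 0)"
  by (induction ys) auto

section \<open>Soundness\<close>

text \<open>Negation merely exchanges the two kinds of support, so both are positive in
  \<open>T\<close> and \<open>F\<close>.\<close>

lemma bd_mono:
  assumes "T \<subseteq> T'" "F \<subseteq> F'"
  shows "bd_true T F \<phi> \<Longrightarrow> bd_true T' F' \<phi>" "bd_false T F \<phi> \<Longrightarrow> bd_false T' F' \<phi>"
  by (induction \<phi>) (use assms in auto)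

section \<open>Covers in bounded lattices\<close>

context bounded_lattice
begin

text \<open>\<open>covers P a\<close> says that \<open>a\<close> is the join of the elements satisfying \<open>P\<close>, even after meeting
  with any \<open>w\<close>.  The parameter \<open>w\<close> is what makes the notion stable under meets without
  mentioning infinite joins or normal forms.\<close>

definition covers :: "('a \<Rightarrow> bool) \<Rightarrow> 'a \<Rightarrow> bool" where
  "covers P a \<longleftrightarrow> a \<in> carrier L \<and> (\<forall>w\<in>carrier L. \<forall>u\<in>carrier L.
     (\<forall>z\<in>carrier L. z \<sqsubseteq> w \<longrightarrow> P z \<longrightarrow> z \<sqsubseteq> u) \<longrightarrow> w \<sqinter> a \<sqsubseteq> u)"

lemma coversD:
  assumes "covers P a" "w \<in> carrier L" "u \<in> carrier L"
    and "\<And>z. \<lbrakk>z \<in> carrier L; z \<sqsubseteq> w; P z\<rbrakk> \<Longrightarrow> z \<sqsubseteq> u"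
  shows "w \<sqinter> a \<sqsubseteq> u"
  using assms unfolding covers_def by simp

lemma covers_le:
  assumes "a \<in> carrier L"
  shows "covers (\<lambda>z. z \<sqsubseteq> a) a"
  unfolding covers_def using assms by (auto simp: meet_left meet_right)

text \<open>The cover of \<open>b\<close> is used below \<open>w \<sqinter> a\<close>, and then the
  cover of \<open>a\<close> below each \<open>z\<close> found there; by \<open>down\<close>, the
  elements below \<open>z\<close> still satisfy \<open>Q\<close>.\<close>

lemma covers_meet:
  assumes P: "covers P a" and Q: "covers Q b"
    and down: "\<And>z z'. \<lbrakk>Q z; z' \<sqsubseteq> z; z \<in> carrier L; z' \<in> carrier L\<rbrakk> \<Longrightarrow> Q z'"
  shows "covers (\<lambda>z. P z \<and> Q z) (a \<sqinter> b)"
  unfolding covers_def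
proof (intro conjI ballI impI)
  have a: "a \<in> carrier L" and b: "b \<in> carrier L"
    using P Q by (auto simp: covers_def)
  then show "a \<sqinter> b \<in> carrier L" by simp
  fix w u
  assume w: "w \<in> carrier L" and u: "u \<in> carrier L"
    and h: "\<forall>z\<in>carrier L. z \<sqsubseteq> w \<longrightarrow> P z \<and> Q z \<longrightarrow> z \<sqsubseteq> u"
  have "(w \<sqinter> a) \<sqinter> b \<sqsubseteq> u"
  proof -
    have "z \<sqsubseteq> u" if z: "z \<in> carrier L" and zw: "z \<sqsubseteq> w \<sqinter> a" and Qz: "Q z" for z
    proof -
      have "z' \<sqsubseteq> u" if "z' \<in> carrier L" "z' \<sqsubseteq> z" "P z'" for z'
        using that z Qz zw h down[OF Qz \<open>z' \<sqsubseteq> z\<close> z] w a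
        by (meson le_trans meet_closed meet_left)
      then have "z \<sqinter> a \<sqsubseteq> u"
        using coversD[OF P z u] by blast
      \<comment> \<open>Here \<open>z\<close> lies below \<open>w \<sqinter> a\<close>, hence below
        \<open>a\<close>, so meeting with \<open>a\<close> loses nothing.\<close>
      moreover have "z \<sqsubseteq> z \<sqinter> a"
        using z zw w a by (meson le_trans meet_closed meet_right meet_le le_refl)
      ultimately show ?thesis
        using z a u by (meson le_trans meet_closed)
    qed
    then show ?thesis
      using coversD[OF Q] w a u by simp
  qed
  then show "w \<sqinter> (a \<sqinter> b) \<sqsubseteq> u"
    using w a b weak_meet_assoc[of w a b] by (simp add: eq_is_equal)
qed

end

section \<open>Covers and finite bounds in De Morgan algebras\<close>

context de_morgan_algebra
begin

text \<open>Distributivity enters here: it splits \<open>w \<sqinter> (a \<squnion> b)\<close> into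
  two meets, each handled by one of the covers.\<close>

lemma covers_join:
  assumes P: "covers P a" and Q: "covers Q b"
  shows "covers (\<lambda>z. P z \<or> Q z) (a \<squnion> b)"
  unfolding covers_def
proof (intro conjI ballI impI)
  have a: "a \<in> carrier A" and b: "b \<in> carrier A"
    using P Q by (auto simp: covers_def)
  then show "a \<squnion> b \<in> carrier A" by simp
  fix w u
  assume w: "w \<in> carrier A" and u: "u \<in> carrier A"
    and h: "\<forall>z\<in>carrier A. z \<sqsubseteq> w \<longrightarrow> P z \<or> Q z \<longrightarrow> z \<sqsubseteq> u"
  have "w \<sqinter> a \<sqsubseteq> u" "w \<sqinter> b \<sqsubseteq> u"
    using h by (auto intro!: coversD[OF P w u] coversD[OF Q w u])
  then show "w \<sqinter> (a \<squnion> b) \<sqsubseteq> u"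
    using w u a b by (simp add: meet_join_distrib join_le)
qed

lemma neg_meet:
  assumes "x \<in> carrier A" "y \<in> carrier A"
  shows "neg A (x \<sqinter> y) = neg A x \<squnion> neg A y"
proof -
  have "neg A (neg A x \<squnion> neg A y) = x \<sqinter> y"
    using assms by (simp add: neg_join neg_closed neg_neg)
  then show ?thesis
    using neg_neg[of "neg A x \<squnion> neg A y"] assms by (simp add: neg_closed)
qed

lemma sup_le_iff:
  assumes "finite X" "X \<subseteq> carrier A" "X \<noteq> {}" "u \<in> carrier A"
  shows "\<Squnion>X \<sqsubseteq> u \<longleftrightarrow> (\<forall>x\<in>X. x \<sqsubseteq> u)"
proof -
  have l: "least A (\<Squnion>X) (Upper A X)"
    by (rule finite_sup_least[OF assms(1-3)])
  show ?thesis
  proof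
    assume le: "\<Squnion>X \<sqsubseteq> u"
    show "\<forall>x\<in>X. x \<sqsubseteq> u"
      using le_trans[OF least_Upper_above[OF l _ assms(2)] le] assms by auto
  next
    assume "\<forall>x\<in>X. x \<sqsubseteq> u"
    then show "\<Squnion>X \<sqsubseteq> u"
      using assms(4) by (intro least_le[OF l] Upper_memI) auto
  qed
qed

lemma le_inf_iff:
  assumes "finite X" "X \<subseteq> carrier A" "X \<noteq> {}" "u \<in> carrier A"
  shows "u \<sqsubseteq> \<Sqinter>X \<longleftrightarrow> (\<forall>x\<in>X. u \<sqsubseteq> x)"
proof -
  have l: "greatest A (\<Sqinter>X) (Lower A X)"
    by (rule finite_inf_greatest[OF assms(1-3)])
  show ?thesis
  proof
    assume le: "u \<sqsubseteq> \<Sqinter>X"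
    show "\<forall>x\<in>X. u \<sqsubseteq> x"
      using le_trans[OF le greatest_Lower_below[OF l _ assms(2)]] assms by auto
  next
    assume "\<forall>x\<in>X. u \<sqsubseteq> x"
    then show "u \<sqsubseteq> \<Sqinter>X"
      using assms(4) by (intro greatest_le[OF l] Lower_memI) auto
  qed
qed

text \<open>Lets a fold of binary joins be compared with a finite supremum through upper bounds
  alone.\<close>

lemma eq_if_same_upper_bounds:
  assumes "x \<in> carrier A" "y \<in> carrier A" "\<And>u. u \<in> carrier A \<Longrightarrow> x \<sqsubseteq> u \<longleftrightarrow> y \<sqsubseteq> u"
  shows "x = y"
  using assms(3)[OF assms(1)] assms(3)[OF assms(2)] assms(1,2)
  by (intro le_antisym) auto

lemma eq_if_same_lower_bounds:
  assumes "x \<in> carrier A" "y \<in> carrier A" "\<And>u. u \<in> carrier A \<Longrightarrow> u \<sqsubseteq> x \<longleftrightarrow> u \<sqsubseteq> y"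
  shows "x = y"
  using assms(3)[OF assms(1)] assms(3)[OF assms(2)] assms(1,2)
  by (intro le_antisym) auto

lemma join_le_iff:
  assumes "x \<in> carrier A" "y \<in> carrier A" "u \<in> carrier A"
  shows "x \<squnion> y \<sqsubseteq> u \<longleftrightarrow> x \<sqsubseteq> u \<and> y \<sqsubseteq> u"
  using assms join_le[of x u y] le_trans[OF join_left, of x y u] le_trans[OF join_right, of x y u]
  by auto

lemma le_joinI1:
  assumes "z \<sqsubseteq> x" "x \<in> carrier A" "y \<in> carrier A" "z \<in> carrier A"
  shows "z \<sqsubseteq> x \<squnion> y"
  by (rule le_trans[OF assms(1) join_left]) (simp_all add: assms)

lemma le_joinI2:
  assumes "z \<sqsubseteq> y" "x \<in> carrier A" "y \<in> carrier A" "z \<in> carrier A"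
  shows "z \<sqsubseteq> x \<squnion> y"
  by (rule le_trans[OF assms(1) join_right]) (simp_all add: assms)

lemma le_meet_iff:
  assumes "x \<in> carrier A" "y \<in> carrier A" "u \<in> carrier A"
  shows "u \<sqsubseteq> x \<sqinter> y \<longleftrightarrow> u \<sqsubseteq> x \<and> u \<sqsubseteq> y"
  using assms meet_le[of u x y] le_trans[OF _ meet_left, of u x y] le_trans[OF _ meet_right, of u x y]
  by auto

end

section \<open>Four-valued forcing in a model\<close>

context belief_model
begin

definition forces :: "'a \<Rightarrow> 'p bd \<Rightarrow> bool" where
  "forces z \<phi> \<longleftrightarrow> bd_true {p. z \<sqsubseteq> v (Atom p)} {p. z \<sqsubseteq> neg A (v (Atom p))} \<phi>"

text \<open>A smaller element lies below more literals, and support grows with both sets of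
  literals.\<close>

lemma forces_antimono:
  assumes "forces z \<phi>" "z' \<sqsubseteq> z" "z \<in> carrier A" "z' \<in> carrier A"
  shows "forces z' \<phi>"
  using assms(1) unfolding forces_def
  by (rule bd_mono[rotated 2])
    (use assms v_closed neg_closed in \<open>auto intro: le_trans\<close>)

lemma forces_simps:
  "forces z (Atom p) \<longleftrightarrow> z \<sqsubseteq> v (Atom p)"
  "forces z (Conj \<phi> \<psi>) \<longleftrightarrow> forces z \<phi> \<and> forces z \<psi>"
  "forces z (Disj \<phi> \<psi>) \<longleftrightarrow> forces z \<phi> \<or> forces z \<psi>"
  "forces z (Neg (Atom p)) \<longleftrightarrow> z \<sqsubseteq> neg A (v (Atom p))"
  "forces z (Neg (Neg \<phi>)) \<longleftrightarrow> forces z \<phi>"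
  "forces z (Neg (Conj \<phi> \<psi>)) \<longleftrightarrow> forces z (Neg \<phi>) \<or> forces z (Neg \<psi>)"
  "forces z (Neg (Disj \<phi> \<psi>)) \<longleftrightarrow> forces z (Neg \<phi>) \<and> forces z (Neg \<psi>)"
  by (simp_all add: forces_def)

lemma v_simps:
  "v (Neg (Neg \<phi>)) = v \<phi>"
  "v (Neg (Conj \<phi> \<psi>)) = v (Neg \<phi>) \<squnion> v (Neg \<psi>)"
  "v (Neg (Disj \<phi> \<psi>)) = v (Neg \<phi>) \<sqinter> v (Neg \<psi>)"
  by (simp_all add: v_Neg v_Conj v_Disj v_closed neg_neg neg_meet neg_join)

text \<open>Negations are pushed inwards to the atoms, so the induction must carry
  \<open>Neg \<phi>\<close> along with \<open>\<phi>\<close>. The converse can fail at joins: an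
  element below a join need not be below either part. Covers make up for this.\<close>

lemma le_if_forces:
  assumes "z \<in> carrier A"
  shows "(forces z \<phi> \<longrightarrow> z \<sqsubseteq> v \<phi>) \<and> (forces z (Neg \<phi>) \<longrightarrow> z \<sqsubseteq> v (Neg \<phi>))"
proof (induction \<phi>)
  case (Atom p)
  show ?case by (simp add: forces_simps v_Neg)
next
  case (Neg \<phi>)
  then show ?case by (simp add: forces_simps v_simps)
next
  case (Conj \<phi> \<psi>)
  then show ?case
    using assms le_joinI1[OF _ v_closed v_closed assms] le_joinI2[OF _ v_closed v_closed assms]
    by (fastforce simp: forces_simps v_simps v_Conj le_meet_iff v_closed)
next
  case (Disj \<phi> \<psi>)
  then show ?case
    using assms le_joinI1[OF _ v_closed v_closed assms] le_joinI2[OF _ v_closed v_closed assms]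
    by (fastforce simp: forces_simps v_simps v_Disj le_meet_iff v_closed)
qed

text \<open>The same paired induction; \<open>forces_antimono\<close> provides the downward closure
  that \<open>covers_meet\<close> demands.\<close>

lemma covers_v: "covers (\<lambda>z. forces z \<phi>) (v \<phi>) \<and> covers (\<lambda>z. forces z (Neg \<phi>)) (v (Neg \<phi>))"
proof (induction \<phi>)
  case (Atom p)
  show ?case by (simp add: forces_simps v_Neg covers_le v_closed neg_closed)
next
  case (Neg \<phi>)
  then show ?case by (simp add: forces_simps v_simps)
next
  case (Conj \<phi> \<psi>)
  then show ?case
    unfolding forces_simps v_simps v_Conj
    by (intro conjI covers_meet covers_join) (blast | rule forces_antimono; assumption)+
next
  case (Disj \<phi> \<psi>)
  then show ?case
    unfolding forces_simps v_simps v_Disj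
    by (intro conjI covers_meet covers_join) (blast | rule forces_antimono; assumption)+
qed

text \<open>Whatever forces \<open>\<phi>\<close> also forces \<open>\<psi>\<close> by entailment
  and so lies below \<open>v \<psi>\<close>. The cover of \<open>v \<phi>\<close>, used with
  \<open>w = v \<phi>\<close>, passes this bound on to \<open>v \<phi>\<close> itself.\<close>

lemma v_mono:
  assumes "\<phi> \<turnstile>\<^sub>B\<^sub>D \<psi>"
  shows "v \<phi> \<sqsubseteq> v \<psi>"
proof -
  have "z \<sqsubseteq> v \<psi>" if "z \<in> carrier A" "forces z \<phi>" for z
    using that le_if_forces[of z \<psi>] assms by (auto simp: forces_def bd_entails_def)
  then have "v \<phi> \<sqinter> v \<phi> \<sqsubseteq> v \<psi>"
    by (intro coversD[OF conjunct1[OF covers_v]] v_closed)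
  moreover have "v \<phi> \<sqsubseteq> v \<phi> \<sqinter> v \<phi>"
    by (simp add: le_meet_iff v_closed)
  ultimately show ?thesis
    using le_trans[of "v \<phi>" "v \<phi> \<sqinter> v \<phi>" "v \<psi>"] v_closed by simp
qed

lemma v_big_disj:
  assumes "\<phi>s \<noteq> []"
  shows "v (big_disj \<phi>s) = \<Squnion>(v ` set \<phi>s)"
proof (rule eq_if_same_upper_bounds)
  fix u assume u: "u \<in> carrier A"
  have "v (foldl Disj \<phi> \<psi>s) \<sqsubseteq> u \<longleftrightarrow> v \<phi> \<sqsubseteq> u \<and> (\<forall>\<psi>\<in>set \<psi>s. v \<psi> \<sqsubseteq> u)" for \<phi> \<psi>s
    by (induction \<psi>s arbitrary: \<phi>) (auto simp: v_Disj join_le_iff v_closed u)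
  then show "v (big_disj \<phi>s) \<sqsubseteq> u \<longleftrightarrow> \<Squnion>(v ` set \<phi>s) \<sqsubseteq> u"
    using assms u v_closed
    by (subst sup_le_iff) (auto simp: big_disj_def neq_Nil_conv)
qed (use assms v_closed in \<open>auto intro!: finite_sup_closed\<close>)

lemma v_big_conj:
  assumes "\<phi>s \<noteq> []"
  shows "v (big_conj \<phi>s) = \<Sqinter>(v ` set \<phi>s)"
proof (rule eq_if_same_lower_bounds)
  fix u assume u: "u \<in> carrier A"
  have "u \<sqsubseteq> v (foldl Conj \<phi> \<psi>s) \<longleftrightarrow> u \<sqsubseteq> v \<phi> \<and> (\<forall>\<psi>\<in>set \<psi>s. u \<sqsubseteq> v \<psi>)" for \<phi> \<psi>s
    by (induction \<psi>s arbitrary: \<phi>) (auto simp: v_Conj le_meet_iff v_closed u)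
  then show "u \<sqsubseteq> v (big_conj \<phi>s) \<longleftrightarrow> u \<sqsubseteq> \<Sqinter>(v ` set \<phi>s)"
    using assms u v_closed
    by (subst le_inf_iff) (auto simp: big_conj_def neq_Nil_conv)
qed (use assms v_closed in \<open>auto intro!: finite_inf_closed\<close>)

lemma B3_holds:
  assumes "\<phi>s \<noteq> []"
  shows "(\<Sum>\<psi>s\<leftarrow>subseqs \<phi>s. if \<psi>s = [] then 0 else (- 1) ^ length \<psi>s * bel1 (v (big_conj \<psi>s)))
    + bel1 (v (big_disj \<phi>s)) \<ge> 0"
proof -
  define k where "k = length \<phi>s"
  \<comment> \<open>Index sets in \<open>general_belief\<close> start at 1, list positions at
    0.\<close>
  define \<phi> where "\<phi> i = \<phi>s ! (i - 1)" for i
  define a where "a = v \<circ> \<phi>"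
  have \<phi>s: "\<phi>s = map \<phi> [1..<Suc k]"
    by (rule nth_equalityI) (auto simp: k_def \<phi>_def simp del: upt_Suc)
  have set: "set \<phi>s = \<phi> ` {1..k}"
    by (subst \<phi>s) (auto simp del: upt_Suc)
  \<comment> \<open>The value 0 at the empty set is what \<open>sum_list_subseqs_map\<close> asks
    for. The sign is opposite to that in \<open>general_belief\<close>, since B3 has its terms on
    the left-hand side.\<close>
  define f where "f n X = (if X = {} then 0 else (- 1) ^ n * bel1 (\<Sqinter>(v ` X)))" for n :: nat and X
  have "(\<Sum>\<psi>s\<leftarrow>subseqs \<phi>s. if \<psi>s = [] then 0 else (- 1) ^ length \<psi>s * bel1 (v (big_conj \<psi>s)))
      = (\<Sum>\<psi>s\<leftarrow>subseqs \<phi>s. f (length \<psi>s) (set \<psi>s))"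
    by (rule arg_cong[where f = sum_list], rule map_cong) (auto simp: f_def v_big_conj)
  also have "\<dots> = (\<Sum>J | J \<subseteq> {1..k} \<and> J \<noteq> {}. f (card J) (\<phi> ` J))"
    unfolding \<phi>s by (rule sum_list_subseqs_map) (simp add: f_def)
  also have "\<dots> = - (\<Sum>J | J \<subseteq> {1..k} \<and> J \<noteq> {}. (- 1) ^ (card J + 1) * bel1 (\<Sqinter>(a ` J)))"
    unfolding sum_negf[symmetric] by (rule sum.cong) (auto simp: f_def a_def image_comp)
  also have "\<dots> \<ge> - bel1 (\<Squnion>(a ` {1..k}))"
  proof -
    have "k \<ge> 1" using assms by (cases \<phi>s) (auto simp: k_def)
    moreover have "a ` {1..k} \<subseteq> carrier A" by (auto simp: a_def v_closed)
    ultimately have "(\<Sum>J | J \<subseteq> {1..k} \<and> J \<noteq> {}. (- 1) ^ (card J + 1) * bel1 (\<Sqinter>(a ` J)))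
        \<le> bel1 (\<Squnion>(a ` {1..k}))"
      using bel1 unfolding general_belief_def by blast
    then show ?thesis by linarith
  qed
  finally show ?thesis
    using v_big_disj[OF assms] by (simp add: set a_def image_comp)
qed

end

section \<open>Soundness of the axioms and rules\<close>

lemma general_belief_mono:
  assumes "general_belief L b" "x \<in> carrier L" "y \<in> carrier L" "x \<sqsubseteq>\<^bsub>L\<^esub> y"
  shows "b x \<le> b y"
  using assms unfolding general_belief_def by blast

lemma bval_subst: "bval I (subst \<sigma> \<tau>) \<longleftrightarrow> bval (\<lambda>a. bval I (\<sigma> a)) \<tau>"
  by (induction \<tau>) auto

lemma ineq_holds_map: "ineq_holds e (map_ineq \<sigma> \<gamma>) \<longleftrightarrow> ineq_holds (e \<circ> \<sigma>) \<gamma>"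
  by (cases \<gamma>) (simp add: comp_def case_prod_unfold)

lemma bval_map: "bval (ineq_holds e) (map_bform (map_ineq \<sigma>) \<gamma>) \<longleftrightarrow> bval (ineq_holds (e \<circ> \<sigma>)) \<gamma>"
  by (induction \<gamma>) (auto simp: ineq_holds_map comp_def)

lemma bval_Imp: "bval I (Imp \<alpha> \<beta>) \<longleftrightarrow> (bval I \<alpha> \<longrightarrow> bval I \<beta>)"
  by (simp add: Imp_def)

lemma (in belief_model) soundness:
  assumes "bBD_derivable \<alpha>"
  shows "satisfies v bel1 bel2 \<alpha>"
  using assms
proof induction
  case (taut \<tau> \<sigma>)
  then show ?case by (simp add: satisfies_def bval_subst)
next
  case (lin \<gamma> \<sigma>)
  then show ?case by (simp add: satisfies_def bval_map)
next
  case (mp \<alpha> \<beta>)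
  then show ?case by (simp add: satisfies_def bval_Imp)
next
  case (B3 \<phi>s)
  have "(\<Sum>(n, t)\<leftarrow>[((- 1) ^ length \<psi>s, BPlus (big_conj \<psi>s)). \<psi>s \<leftarrow> subseqs \<phi>s, \<psi>s \<noteq> []].
        real_of_int n * bterm_value v bel1 bel2 t) =
     (\<Sum>\<psi>s\<leftarrow>subseqs \<phi>s. if \<psi>s = [] then 0 else (- 1) ^ length \<psi>s * bel1 (v (big_conj \<psi>s)))"
    for \<phi>s
    by (subst sum_list_concat_if) (auto intro!: arg_cong[where f = sum_list])
  with B3_holds[OF B3] show ?case by (simp add: satisfies_def)
next
  case (B4_plus \<phi> \<phi>')
  then show ?case
    using general_belief_mono[OF bel1 v_closed v_closed] v_mono[OF B4_plus]
    by (simp add: satisfies_def)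
next
  case (B4_minus \<phi> \<phi>')
  then show ?case
    \<comment> \<open>In \<open>inv_gorder A\<close> the order is reversed, hence the exchanged
      arguments.\<close>
    using general_belief_mono[OF bel2, of "v \<phi>'" "v \<phi>"] v_mono[OF B4_minus]
    by (simp add: satisfies_def v_closed)
next
  case (B2_minus \<phi>)
  then show ?case using bel2_neg[OF v_closed[of \<phi>]] by (simp add: satisfies_def v_Neg)
next
  case (B2_plus \<phi>)
  then show ?case using bel1_neg[OF v_closed[of \<phi>]] by (simp add: satisfies_def v_Neg)
qed (use bel1 bel2 v_closed in \<open>auto simp: satisfies_def general_belief_def\<close>)

section \<open>Linear consequences of derivable formulas\<close>

text \<open>Rule \<open>lin\<close> speaks of inequalities over \<open>nat\<close>; countability
  allows belief terms to be coded as such variables.\<close>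

instance bd :: (countable) countable
  by countable_datatype

instance bterm :: (countable) countable
  by countable_datatype

text \<open>Premises are discharged one by one as antecedents of implications until a formula true
  under every assignment remains, which is an instance of \<open>lin\<close>.\<close>

lemma derivable_if_linear_consequence:
  fixes \<beta> :: "'p::countable belief_formula"
  assumes "finite \<Gamma>" "\<And>\<gamma>. \<gamma> \<in> \<Gamma> \<Longrightarrow> bBD_derivable \<gamma>"
    and "\<And>e. \<forall>\<gamma>\<in>\<Gamma>. bval (ineq_holds e) \<gamma> \<Longrightarrow> bval (ineq_holds e) \<beta>"
  shows "bBD_derivable \<beta>"
  using assms
proof (induction arbitrary: \<beta> rule: finite_induct)
  case empty
  \<comment> \<open>Belief terms are coded by \<open>to_nat\<close> to meet the format of
    \<open>lin\<close>; the substitution \<open>from_nat\<close> decodes them.\<close>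
  have "bBD_derivable (map_bform (map_ineq (from_nat :: nat \<Rightarrow> 'p bterm)) (map_bform (map_ineq to_nat) \<beta>))"
    by (rule lin) (use empty in \<open>simp add: bval_map\<close>)
  then show ?case
    by (simp add: bform.map_comp ineq.map_comp comp_def bform.map_ident ineq.map_ident)
next
  case (insert \<gamma> \<Gamma>)
  have "bBD_derivable (Imp \<gamma> \<beta>)"
    by (rule insert.IH) (use insert.prems in \<open>auto simp: bval_Imp\<close>)
  then show ?case
    using insert.prems(1) by (rule mp[rotated]) simp
qed

section \<open>De Morgan algebras of sets\<close>

definition set_belief :: "'s set set \<Rightarrow> ('s set \<Rightarrow> real) \<Rightarrow> bool" where
  "set_belief C b \<longleftrightarrow> (\<forall>S\<in>C. 0 \<le> b S \<and> b S \<le> 1) \<and> (\<forall>S\<in>C. \<forall>T\<in>C. S \<subseteq> T \<longrightarrow> b S \<le> b T) \<and>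
    (\<forall>k\<ge>1. \<forall>a :: nat \<Rightarrow> 's set. a ` {1..k} \<subseteq> C \<longrightarrow>
      (\<Sum>J | J \<subseteq> {1..k} \<and> J \<noteq> {}. (- 1) ^ (card J + 1) * b (\<Inter>(a ` J))) \<le> b (\<Union>(a ` {1..k})))"

lemma set_belief_bounds: "\<lbrakk>set_belief C b; S \<in> C\<rbrakk> \<Longrightarrow> 0 \<le> b S \<and> b S \<le> 1"
  unfolding set_belief_def by blast

lemma set_belief_mono: "\<lbrakk>set_belief C b; S \<in> C; T \<in> C; S \<subseteq> T\<rbrakk> \<Longrightarrow> b S \<le> b T"
  unfolding set_belief_def by blast

text \<open>The map \<open>\<iota>\<close> copies the family into \<open>'m\<close>, because
  \<open>valid\<close> only sees algebras carried by that type. The involution \<open>ng\<close>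
  need not be set complement.\<close>

locale de_morgan_sets =
  fixes C :: "'s set set" and ng :: "'s set \<Rightarrow> 's set" and \<iota> :: "'s set \<Rightarrow> 'm"
  assumes finite_C: "finite C" and C_nonempty: "C \<noteq> {}"
    and Un_closed: "\<lbrakk>S \<in> C; T \<in> C\<rbrakk> \<Longrightarrow> S \<union> T \<in> C"
    and Int_closed: "\<lbrakk>S \<in> C; T \<in> C\<rbrakk> \<Longrightarrow> S \<inter> T \<in> C"
    and ng_closed: "S \<in> C \<Longrightarrow> ng S \<in> C"
    and ng_ng: "S \<in> C \<Longrightarrow> ng (ng S) = S"
    and ng_Un: "\<lbrakk>S \<in> C; T \<in> C\<rbrakk> \<Longrightarrow> ng (S \<union> T) = ng S \<inter> ng T"
    and inj: "inj_on \<iota> C"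
begin

abbreviation un\<iota> :: "'m \<Rightarrow> 's set" where
  "un\<iota> \<equiv> inv_into C \<iota>"

definition alg :: "'m de_morgan" where
  "alg = \<lparr>carrier = \<iota> ` C, eq = (=), le = (\<lambda>x y. un\<iota> x \<subseteq> un\<iota> y), neg = (\<lambda>x. \<iota> (ng (un\<iota> x)))\<rparr>"

lemma un\<iota>: "S \<in> C \<Longrightarrow> un\<iota> (\<iota> S) = S"
  using inj by simp

lemma alg_simps:
  "carrier alg = \<iota> ` C"
  "eq alg = (=)"
  "le alg x y \<longleftrightarrow> un\<iota> x \<subseteq> un\<iota> y"
  "S \<in> C \<Longrightarrow> neg alg (\<iota> S) = \<iota> (ng S)"
  by (simp_all add: alg_def un\<iota>)

lemma Union_closed:
  assumes "X \<subseteq> C" "X \<noteq> {}"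
  shows "\<Union>X \<in> C"
proof -
  have "finite X" using assms finite_C finite_subset by blast
  then show ?thesis
    using assms(2,1) by (induction rule: finite_ne_induct) (auto simp: Un_closed)
qed

lemma Inter_closed:
  assumes "X \<subseteq> C" "X \<noteq> {}"
  shows "\<Inter>X \<in> C"
proof -
  have "finite X" using assms finite_C finite_subset by blast
  then show ?thesis
    using assms(2,1) by (induction rule: finite_ne_induct) (auto simp: Int_closed)
qed

sublocale partial_order alg
  by unfold_locales (auto simp: alg_simps un\<iota>)

lemma least_sup:
  assumes "X \<subseteq> C" "X \<noteq> {}"
  shows "least alg (\<iota> (\<Union>X)) (Upper alg (\<iota> ` X))"
proof (rule least_UpperI)
  show "\<iota> ` X \<subseteq> carrier alg" "\<iota> (\<Union>X) \<in> carrier alg"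
    using assms Union_closed by (auto simp: alg_simps)
  show "le alg x (\<iota> (\<Union>X))" if "x \<in> \<iota> ` X" for x
    using that assms Union_closed[OF assms] by (auto simp: alg_simps un\<iota> subset_iff)
  show "le alg (\<iota> (\<Union>X)) y" if "y \<in> Upper alg (\<iota> ` X)" for y
    using that assms Union_closed[OF assms]
    by (fastforce simp: alg_simps un\<iota> Upper_def subset_iff)
qed

lemma greatest_inf:
  assumes "X \<subseteq> C" "X \<noteq> {}"
  shows "greatest alg (\<iota> (\<Inter>X)) (Lower alg (\<iota> ` X))"
proof (rule greatest_LowerI)
  show "\<iota> ` X \<subseteq> carrier alg" "\<iota> (\<Inter>X) \<in> carrier alg"
    using assms Inter_closed by (auto simp: alg_simps)
  show "le alg (\<iota> (\<Inter>X)) x" if "x \<in> \<iota> ` X" for x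
    using that assms Inter_closed[OF assms] by (auto simp: alg_simps un\<iota> subset_iff)
  show "le alg y (\<iota> (\<Inter>X))" if "y \<in> Lower alg (\<iota> ` X)" for y
    using that assms Inter_closed[OF assms]
    by (fastforce simp: alg_simps un\<iota> Lower_def subset_iff)
qed

text \<open>The supremum is defined by choice; uniqueness of least elements identifies it.\<close>

lemma sup_alg:
  assumes "X \<subseteq> C" "X \<noteq> {}"
  shows "\<Squnion>\<^bsub>alg\<^esub>(\<iota> ` X) = \<iota> (\<Union>X)"
  unfolding sup_def
  by (rule some_equality[where P = "\<lambda>x. least alg x (Upper alg (\<iota> ` X))", OF least_sup[OF assms]])
    (rule least_unique[OF _ least_sup[OF assms]])

lemma inf_alg:
  assumes "X \<subseteq> C" "X \<noteq> {}"
  shows "\<Sqinter>\<^bsub>alg\<^esub>(\<iota> ` X) = \<iota> (\<Inter>X)"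
  unfolding inf_def
  by (rule some_equality[where P = "\<lambda>x. greatest alg x (Lower alg (\<iota> ` X))", OF greatest_inf[OF assms]])
    (rule greatest_unique[OF _ greatest_inf[OF assms]])

lemma join_alg: "\<lbrakk>S \<in> C; T \<in> C\<rbrakk> \<Longrightarrow> \<iota> S \<squnion>\<^bsub>alg\<^esub> \<iota> T = \<iota> (S \<union> T)"
  using sup_alg[of "{S, T}"] by (simp add: join_def)

lemma meet_alg: "\<lbrakk>S \<in> C; T \<in> C\<rbrakk> \<Longrightarrow> \<iota> S \<sqinter>\<^bsub>alg\<^esub> \<iota> T = \<iota> (S \<inter> T)"
  using inf_alg[of "{S, T}"] by (simp add: meet_def)

sublocale de_morgan_algebra alg
proof unfold_locales
  show "\<exists>s. least alg s (Upper alg {x, y})" if "x \<in> carrier alg" "y \<in> carrier alg" for x y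
    using that least_sup[of "{un\<iota> x, un\<iota> y}"] by (auto simp: alg_simps un\<iota>)
  show "\<exists>s. greatest alg s (Lower alg {x, y})" if "x \<in> carrier alg" "y \<in> carrier alg" for x y
    using that greatest_inf[of "{un\<iota> x, un\<iota> y}"] by (auto simp: alg_simps un\<iota>)
  \<comment> \<open>The family need not contain the empty set or \<open>UNIV\<close>; its own
    intersection and union serve as bounds.\<close>
  show "\<exists>x. least alg x (carrier alg)"
    using Inter_closed[of C] C_nonempty
    by (intro exI[of _ "\<iota> (\<Inter>C)"]) (auto simp: least_def alg_simps un\<iota>)
  show "\<exists>x. greatest alg x (carrier alg)"
    using Union_closed[of C] C_nonempty
    by (intro exI[of _ "\<iota> (\<Union>C)"]) (auto simp: greatest_def alg_simps un\<iota>)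
qed (auto simp: alg_simps join_alg meet_alg Un_closed Int_closed ng_closed ng_ng ng_Un Int_Un_distrib)

lemma ng_Int:
  assumes "S \<in> C" "T \<in> C"
  shows "ng (S \<inter> T) = ng S \<union> ng T"
  using ng_Un[of "ng S" "ng T"] ng_ng[of "ng S \<union> ng T"] assms
  by (simp add: ng_closed ng_ng Un_closed)

lemma ng_mono: "\<lbrakk>S \<in> C; T \<in> C; S \<subseteq> T\<rbrakk> \<Longrightarrow> ng T \<subseteq> ng S"
  using ng_Un[of S T] by (metis Int_lower1 sup.absorb2)

lemma ng_Union:
  assumes "X \<subseteq> C" "X \<noteq> {}"
  shows "ng (\<Union>X) = \<Inter>(ng ` X)"
proof -
  have "finite X" using assms finite_C finite_subset by blast
  then show ?thesis
    using assms(2,1) by (induction rule: finite_ne_induct) (auto simp: ng_Un Union_closed)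
qed

lemma ng_Inter:
  assumes "X \<subseteq> C" "X \<noteq> {}"
  shows "ng (\<Inter>X) = \<Union>(ng ` X)"
proof -
  have "finite X" using assms finite_C finite_subset by blast
  then show ?thesis
    using assms(2,1) by (induction rule: finite_ne_induct) (auto simp: ng_Int Inter_closed)
qed

text \<open>One preimage family serves all index subsets at once, as the inclusion-exclusion sum
  requires.\<close>

lemma lift_family:
  assumes "a ` I \<subseteq> \<iota> ` C"
  obtains c where "c ` I \<subseteq> C" and "\<And>J. J \<subseteq> I \<Longrightarrow> a ` J = \<iota> ` (c ` J)"
proof
  show "(un\<iota> \<circ> a) ` I \<subseteq> C"
    using inv_into_into[of _ \<iota> C] assms by force
  fix J assume "J \<subseteq> I"
  then have "\<iota> (un\<iota> (a i)) = a i" if "i \<in> J" for i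
    using that assms by (intro f_inv_into_f) auto
  then show "a ` J = \<iota> ` ((un\<iota> \<circ> a) ` J)"
    by (simp add: image_image)
qed

lemma general_belief_alg:
  assumes "set_belief C b"
  shows "general_belief alg (\<lambda>x. b (un\<iota> x))"
  unfolding general_belief_def
proof (intro conjI allI impI)
  fix k :: nat and a :: "nat \<Rightarrow> 'm"
  assume k: "1 \<le> k" and "a ` {1..k} \<subseteq> carrier alg"
  then have "a ` {1..k} \<subseteq> \<iota> ` C"
    by (simp add: alg_simps)
  then obtain c where c: "c ` {1..k} \<subseteq> C" and image: "\<And>J. J \<subseteq> {1..k} \<Longrightarrow> a ` J = \<iota> ` (c ` J)"
    by (rule lift_family) (blast intro: that)
  have inf: "un\<iota> (\<Sqinter>\<^bsub>alg\<^esub>(a ` J)) = \<Inter>(c ` J)" if "J \<subseteq> {1..k}" "J \<noteq> {}" for J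
  proof -
    have "c ` J \<subseteq> C" using c that by auto
    then show ?thesis
      unfolding image[OF that(1)] using that by (simp add: inf_alg un\<iota> Inter_closed)
  qed
  have sup: "un\<iota> (\<Squnion>\<^bsub>alg\<^esub>(a ` {1..k})) = \<Union>(c ` {1..k})"
    unfolding image[OF subset_refl] using c k by (simp add: sup_alg un\<iota> Union_closed)
  have "(\<Sum>J | J \<subseteq> {1..k} \<and> J \<noteq> {}. (- 1) ^ (card J + 1) * b (un\<iota> (\<Sqinter>\<^bsub>alg\<^esub>(a ` J)))) =
      (\<Sum>J | J \<subseteq> {1..k} \<and> J \<noteq> {}. (- 1) ^ (card J + 1) * b (\<Inter>(c ` J)))"
    by (rule sum.cong) (use inf in auto)
  also have "\<dots> \<le> b (\<Union>(c ` {1..k}))"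
    using assms k c unfolding set_belief_def by blast
  finally show "(\<Sum>J | J \<subseteq> {1..k} \<and> J \<noteq> {}. (- 1) ^ (card J + 1) * b (un\<iota> (\<Sqinter>\<^bsub>alg\<^esub>(a ` J))))
      \<le> b (un\<iota> (\<Squnion>\<^bsub>alg\<^esub>(a ` {1..k})))"
    unfolding sup .
next
  show "\<forall>x\<in>carrier alg. 0 \<le> b (un\<iota> x) \<and> b (un\<iota> x) \<le> 1"
    by (simp add: alg_simps un\<iota> set_belief_bounds[OF assms])
  show "\<forall>x\<in>carrier alg. \<forall>y\<in>carrier alg. le alg x y \<longrightarrow> b (un\<iota> x) \<le> b (un\<iota> y)"
    by (simp add: alg_simps un\<iota> set_belief_mono[OF assms])
qed

text \<open>Meets of the dual order are joins of \<open>alg\<close>, and \<open>ng\<close> turns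
  unions into intersections. The claim thus becomes the inequality of \<open>b\<close> for the
  family \<open>ng \<circ> c\<close>.\<close>

lemma general_belief_inv_alg:
  assumes "set_belief C b"
  shows "general_belief (inv_gorder alg) (\<lambda>x. b (ng (un\<iota> x)))"
  unfolding general_belief_def
proof (intro conjI allI impI)
  fix k :: nat and a :: "nat \<Rightarrow> 'm"
  assume k: "1 \<le> k" and "a ` {1..k} \<subseteq> carrier (inv_gorder alg)"
  then have "a ` {1..k} \<subseteq> \<iota> ` C"
    by (simp add: alg_simps)
  then obtain c where c: "c ` {1..k} \<subseteq> C" and image: "\<And>J. J \<subseteq> {1..k} \<Longrightarrow> a ` J = \<iota> ` (c ` J)"
    by (rule lift_family) (blast intro: that)
  have sup: "ng (un\<iota> (\<Squnion>\<^bsub>alg\<^esub>(a ` J))) = \<Inter>((ng \<circ> c) ` J)" if "J \<subseteq> {1..k}" "J \<noteq> {}" for J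
  proof -
    have "c ` J \<subseteq> C" using c that by auto
    then show ?thesis
      unfolding image[OF that(1)] using that sup_alg[of "c ` J"]
      by (simp add: un\<iota> Union_closed ng_Union image_comp)
  qed
  have inf: "ng (un\<iota> (\<Sqinter>\<^bsub>alg\<^esub>(a ` {1..k}))) = \<Union>((ng \<circ> c) ` {1..k})"
    unfolding image[OF subset_refl] using c k inf_alg[of "c ` {1..k}"]
    by (simp add: un\<iota> Inter_closed ng_Inter image_comp)
  have "(\<Sum>J | J \<subseteq> {1..k} \<and> J \<noteq> {}. (- 1) ^ (card J + 1) * b (ng (un\<iota> (\<Squnion>\<^bsub>alg\<^esub>(a ` J))))) =
      (\<Sum>J | J \<subseteq> {1..k} \<and> J \<noteq> {}. (- 1) ^ (card J + 1) * b (\<Inter>((ng \<circ> c) ` J)))"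
    by (rule sum.cong) (use sup in auto)
  also have "\<dots> \<le> b (\<Union>((ng \<circ> c) ` {1..k}))"
  proof -
    have "(ng \<circ> c) ` {1..k} \<subseteq> C" using c ng_closed by auto
    with assms k show ?thesis unfolding set_belief_def by blast
  qed
  finally show "(\<Sum>J | J \<subseteq> {1..k} \<and> J \<noteq> {}. (- 1) ^ (card J + 1) *
        b (ng (un\<iota> (\<Sqinter>\<^bsub>inv_gorder alg\<^esub>(a ` J))))) \<le> b (ng (un\<iota> (\<Squnion>\<^bsub>inv_gorder alg\<^esub>(a ` {1..k}))))"
    unfolding sup_dual inf_dual inf .
next
  show "\<forall>x\<in>carrier (inv_gorder alg). 0 \<le> b (ng (un\<iota> x)) \<and> b (ng (un\<iota> x)) \<le> 1"
    by (simp add: alg_simps un\<iota> ng_closed set_belief_bounds[OF assms])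
  show "\<forall>x\<in>carrier (inv_gorder alg). \<forall>y\<in>carrier (inv_gorder alg).
      le (inv_gorder alg) x y \<longrightarrow> b (ng (un\<iota> x)) \<le> b (ng (un\<iota> y))"
    by (simp add: alg_simps un\<iota> ng_closed ng_mono set_belief_mono[OF assms])
qed

end

section \<open>Repetitions in inclusion--exclusion\<close>

text \<open>Relativising to \<open>y\<close> is what yields the recursion
  \<open>alt_sum_Cons\<close>. The empty subsequence is included and contributes
  \<open>b y\<close>.\<close>

definition alt_sum :: "('s set \<Rightarrow> real) \<Rightarrow> 's set list \<Rightarrow> 's set \<Rightarrow> real" where
  "alt_sum b xs y = (\<Sum>zs\<leftarrow>subseqs xs. (- 1) ^ length zs * b (y \<inter> \<Inter>(set zs)))"

lemma alt_sum_Nil [simp]: "alt_sum b [] y = b y"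
  by (simp add: alt_sum_def)

text \<open>Subsequences containing the new head have one more sign and one more intersection with
  \<open>x\<close>.\<close>

lemma alt_sum_Cons [simp]: "alt_sum b (x # xs) y = alt_sum b xs y - alt_sum b xs (y \<inter> x)"
proof -
  have "(\<Sum>z\<leftarrow>zss. - f z) = - (\<Sum>z\<leftarrow>zss. f z)" for f :: "'a set list \<Rightarrow> real" and zss
    by (induction zss) auto
  then show ?thesis
    by (simp add: alt_sum_def Let_def comp_def Int_assoc)
qed

text \<open>By \<open>alt_sum_Cons\<close>, \<open>alt_sum\<close> is an iterated difference, and a difference taken twice with
  respect to the same set is the difference taken once.\<close>

lemma alt_sum_eq_0:
  assumes "x \<in> set xs"
  shows "alt_sum b xs (y \<inter> x) = 0"
  using assms by (induction xs arbitrary: y) (auto simp: Int_assoc, metis Int_commute Int_assoc)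

text \<open>A head that occurs again later only subtracts a term that is 0 by
  \<open>alt_sum_eq_0\<close>.\<close>

lemma alt_sum_remdups: "alt_sum b (remdups xs) y = alt_sum b xs y"
  by (induction xs arbitrary: y) (auto simp: alt_sum_eq_0)

text \<open>The empty intersection is \<open>UNIV\<close>; its dummy value is part of
  \<open>alt_sum\<close> and is subtracted again.\<close>

lemma alt_sum_nonempty:
  "(\<Sum>zs\<leftarrow>subseqs xs. if zs = [] then 0 else (- 1) ^ length zs * b (\<Inter>(set zs))) =
    alt_sum b xs UNIV - b UNIV"
proof -
  have "(\<Sum>zs\<leftarrow>subseqs xs. if zs = [] then 0 else f zs) = (\<Sum>zs\<leftarrow>subseqs xs. f zs) - f []"
    for f :: "'a set list \<Rightarrow> real"
    by (induction xs) (simp_all add: Let_def comp_def)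
  from this[of "\<lambda>zs. (- 1) ^ length zs * b (\<Inter>(set zs))"] show ?thesis
    by (simp add: alt_sum_def)
qed

section \<open>The finite algebra of formulas modulo equivalence\<close>

definition sem :: "'p bd \<Rightarrow> ('p set \<times> 'p set) set" where
  "sem \<phi> = {(T, F). bd_true T F \<phi>}"

text \<open>The passage from \<open>(T, F)\<close> to \<open>(- F, - T)\<close> is the Routley star.
  It expresses falsity through truth, so that negation acts on truth sets alone.\<close>

definition sem_neg :: "('p set \<times> 'p set) set \<Rightarrow> ('p set \<times> 'p set) set" where
  "sem_neg S = {(T, F). (- F, - T) \<notin> S}"

lemma entails_iff_sem: "\<phi> \<turnstile>\<^sub>B\<^sub>D \<psi> \<longleftrightarrow> sem \<phi> \<subseteq> sem \<psi>"
  by (auto simp: bd_entails_def sem_def)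

lemma bd_dual:
  "bd_true (- F) (- T) \<phi> \<longleftrightarrow> \<not> bd_false T F \<phi>"
  "bd_false (- F) (- T) \<phi> \<longleftrightarrow> \<not> bd_true T F \<phi>"
  by (induction \<phi>) auto

lemma sem_Neg: "sem (Neg \<phi>) = sem_neg (sem \<phi>)"
  by (auto simp: sem_def sem_neg_def bd_dual)

lemma sem_Conj: "sem (Conj \<phi> \<psi>) = sem \<phi> \<inter> sem \<psi>"
  by (auto simp: sem_def)

lemma sem_Disj: "sem (Disj \<phi> \<psi>) = sem \<phi> \<union> sem \<psi>"
  by (auto simp: sem_def)

lemma sem_big_conj:
  assumes "\<phi>s \<noteq> []"
  shows "sem (big_conj \<phi>s) = \<Inter>(sem ` set \<phi>s)"
proof -
  have "sem (foldl Conj \<phi> \<psi>s) = sem \<phi> \<inter> \<Inter>(sem ` set \<psi>s)" for \<phi> :: "'a bd" and \<psi>s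
    by (induction \<psi>s arbitrary: \<phi>) (auto simp: sem_Conj)
  then show ?thesis
    using assms by (cases \<phi>s) (auto simp: big_conj_def)
qed

lemma sem_big_disj:
  assumes "\<phi>s \<noteq> []"
  shows "sem (big_disj \<phi>s) = \<Union>(sem ` set \<phi>s)"
proof -
  have "sem (foldl Disj \<phi> \<psi>s) = sem \<phi> \<union> \<Union>(sem ` set \<psi>s)" for \<phi> :: "'a bd" and \<psi>s
    by (induction \<psi>s arbitrary: \<phi>) (auto simp: sem_Disj)
  then show ?thesis
    using assms by (cases \<phi>s) (auto simp: big_disj_def)
qed

text \<open>Closure is witnessed by the connectives, and the star is an involution. With finitely
  many atoms there are only finitely many valuations, hence finitely many truth sets.\<close>

lemma de_morgan_sets_sem:
  fixes \<iota> :: "('p::finite set \<times> 'p set) set \<Rightarrow> 'm"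
  assumes "inj \<iota>"
  shows "de_morgan_sets (range sem) sem_neg \<iota>"
proof unfold_locales
  fix S T :: "('p set \<times> 'p set) set"
  show "S \<union> T \<in> range sem" "S \<inter> T \<in> range sem" if "S \<in> range sem" "T \<in> range sem"
    using that by (auto simp: sem_Disj[symmetric] sem_Conj[symmetric])
  show "sem_neg S \<in> range sem" if "S \<in> range sem"
    using that by (auto simp: sem_Neg[symmetric])
  show "sem_neg (sem_neg S) = S" "sem_neg (S \<union> T) = sem_neg S \<inter> sem_neg T"
    by (auto simp: sem_neg_def)
  show "inj_on \<iota> (range sem)"
    using assms by (rule inj_on_subset) simp
qed auto

section \<open>Representatives and a finite choice of axioms\<close>

definition rep :: "('p set \<times> 'p set) set \<Rightarrow> 'p bd" where
  "rep S = (SOME \<phi>. sem \<phi> = S)"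

lemma sem_rep: "S \<in> range sem \<Longrightarrow> sem (rep S) = S"
  unfolding rep_def by (rule someI_ex) auto

text \<open>Distinctness keeps this set finite; families with repetitions are recovered by
  \<open>alt_sum_remdups\<close>.\<close>

definition rep_lists :: "'p bd list set" where
  "rep_lists = {\<phi>s. set \<phi>s \<subseteq> rep ` range sem \<and> distinct \<phi>s \<and> \<phi>s \<noteq> []}"

lemma finite_rep_lists: "finite (rep_lists :: 'p::finite bd list set)"
  unfolding rep_lists_def
  by (rule finite_subset[OF _ finite_subset_distinct[of "rep ` range sem"]]) auto

text \<open>Besides \<open>\<Phi>\<close>, these are the negations through which B2 reads
  \<open>BMinus\<close>, the representatives that define the belief function, and the formulas in
  the chosen B3 instances.\<close>

definition relevant :: "'p bd set \<Rightarrow> 'p bd set" where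
  "relevant \<Phi> = \<Phi> \<union> Neg ` \<Phi> \<union> rep ` range sem \<union> big_disj ` rep_lists \<union> big_conj ` rep_lists"

text \<open>Finitely many axioms suffice to extend the values of the formulas in \<open>\<Phi>\<close> to a model.\<close>

definition axioms :: "'p bd set \<Rightarrow> 'p belief_formula set" where
  "axioms \<Phi> =
     (\<lambda>\<phi>. Prim (Ge [(1, BPlus \<phi>)] 0)) ` relevant \<Phi> \<union>
     (\<lambda>\<phi>. Prim (Ge [(-1, BPlus \<phi>)] (-1))) ` relevant \<Phi> \<union>
     (\<lambda>\<phi>. And (Prim (Ge [(1, BMinus \<phi>), (-1, BPlus (Neg \<phi>))] 0))
           (Prim (Ge [(1, BPlus (Neg \<phi>)), (-1, BMinus \<phi>)] 0))) ` \<Phi> \<union>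
     (\<lambda>(\<phi>, \<phi>'). Prim (Ge [(1, BPlus \<phi>'), (-1, BPlus \<phi>)] 0)) `
       {(\<phi>, \<phi>'). \<phi> \<in> relevant \<Phi> \<and> \<phi>' \<in> relevant \<Phi> \<and> \<phi> \<turnstile>\<^sub>B\<^sub>D \<phi>'} \<union>
     (\<lambda>\<phi>s. Prim (Ge ((1, BPlus (big_disj \<phi>s)) #
        [((-1) ^ length \<psi>s, BPlus (big_conj \<psi>s)). \<psi>s \<leftarrow> subseqs \<phi>s, \<psi>s \<noteq> []]) 0)) ` rep_lists"

lemma finite_axioms:
  fixes \<Phi> :: "'p::finite bd set"
  assumes "finite \<Phi>"
  shows "finite (axioms \<Phi>)"
proof -
  have fin: "finite (relevant \<Phi>)"
    using assms by (simp add: relevant_def finite_rep_lists)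
  then have "finite {(\<phi>, \<phi>'). \<phi> \<in> relevant \<Phi> \<and> \<phi>' \<in> relevant \<Phi> \<and> \<phi> \<turnstile>\<^sub>B\<^sub>D \<phi>'}"
    by (intro finite_subset[OF _ finite_cartesian_product[OF fin fin]]) auto
  with fin show ?thesis
    using assms by (simp add: axioms_def finite_rep_lists)
qed

lemma derivable_axioms:
  assumes "\<gamma> \<in> axioms \<Phi>"
  shows "bBD_derivable \<gamma>"
  using assms unfolding axioms_def rep_lists_def
  by (elim UnE imageE CollectE case_prodE conjE; simp only: prod.case)
    (rule B1_lower_plus B1_upper_plus B2_minus B4_plus B3; assumption?)+

section \<open>From an assignment of reals to a model\<close>

locale axioms_hold =
  fixes \<Phi> :: "'p::finite bd set" and e :: "'p bterm \<Rightarrow> real"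
  assumes hold: "\<gamma> \<in> axioms \<Phi> \<Longrightarrow> bval (ineq_holds e) \<gamma>"
begin

lemma nonneg: "\<phi> \<in> relevant \<Phi> \<Longrightarrow> 0 \<le> e (BPlus \<phi>)"
  using hold[of "Prim (Ge [(1, BPlus \<phi>)] 0)"] by (auto simp: axioms_def)

lemma le_1: "\<phi> \<in> relevant \<Phi> \<Longrightarrow> e (BPlus \<phi>) \<le> 1"
  using hold[of "Prim (Ge [(-1, BPlus \<phi>)] (-1))"] by (auto simp: axioms_def)

lemma BMinus_eq: "\<phi> \<in> \<Phi> \<Longrightarrow> e (BMinus \<phi>) = e (BPlus (Neg \<phi>))"
  using hold[of "And (Prim (Ge [(1, BMinus \<phi>), (-1, BPlus (Neg \<phi>))] 0))
    (Prim (Ge [(1, BPlus (Neg \<phi>)), (-1, BMinus \<phi>)] 0))"] by (auto simp: axioms_def)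

lemma mono:
  assumes "\<phi> \<in> relevant \<Phi>" "\<phi>' \<in> relevant \<Phi>" "sem \<phi> \<subseteq> sem \<phi>'"
  shows "e (BPlus \<phi>) \<le> e (BPlus \<phi>')"
proof -
  have "Prim (Ge [(1, BPlus \<phi>'), (-1, BPlus \<phi>)] 0) \<in> axioms \<Phi>"
    unfolding axioms_def using assms by (force simp: entails_iff_sem)
  from hold[OF this] show ?thesis by simp
qed

definition b :: "('p set \<times> 'p set) set \<Rightarrow> real" where
  "b S = e (BPlus (rep S))"

lemma rep_relevant: "S \<in> range sem \<Longrightarrow> rep S \<in> relevant \<Phi>"
  by (simp add: relevant_def)

text \<open>A formula and its representative entail each other, so B4 applies in both
  directions.\<close>

lemma b_sem: "\<phi> \<in> relevant \<Phi> \<Longrightarrow> b (sem \<phi>) = e (BPlus \<phi>)"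
  unfolding b_def by (intro antisym mono rep_relevant) (simp_all add: sem_rep)

text \<open>This is B3 for the list of representatives, with each disjunction and conjunction
  replaced by its truth set through \<open>b_sem\<close>.\<close>

lemma alt_sum_bound_distinct:
  assumes "distinct xs" "xs \<noteq> []" "set xs \<subseteq> range sem"
  shows "b UNIV - alt_sum b xs UNIV \<le> b (\<Union>(set xs))"
proof -
  define \<phi>s where "\<phi>s = map rep xs"
  have "inj_on rep (range sem)"
    by (metis inj_onI sem_rep)
  then have \<phi>s: "\<phi>s \<in> rep_lists"
    using assms unfolding rep_lists_def \<phi>s_def
    by (auto simp: distinct_map intro: inj_on_subset)
  have xs: "map sem \<phi>s = xs"
    using assms(3) unfolding \<phi>s_def map_map by (intro map_idI) (auto simp: sem_rep)
  \<comment> \<open>Nonempty subsequences are again in \<open>rep_lists\<close>, which makes their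
    conjunctions relevant.\<close>
  have sub: "\<psi>s \<in> rep_lists" if "\<psi>s \<in> set (subseqs \<phi>s)" "\<psi>s \<noteq> []" for \<psi>s
  proof -
    have "set \<psi>s \<subseteq> set \<phi>s"
      using that(1) subseqs_powset[of \<phi>s] by blast
    then show ?thesis
      using \<phi>s that subseqs_distinctD[OF that(1)] by (auto simp: rep_lists_def)
  qed
  have "(\<Sum>\<psi>s\<leftarrow>subseqs \<phi>s. if \<psi>s = [] then 0 else (- 1) ^ length \<psi>s * e (BPlus (big_conj \<psi>s)))
      = (\<Sum>\<psi>s\<leftarrow>subseqs \<phi>s. if \<psi>s = [] then 0
          else (- 1) ^ length \<psi>s * b (\<Inter>(set (map sem \<psi>s))))"
  proof (rule arg_cong[where f = sum_list], rule map_cong[OF refl])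
    fix \<psi>s assume "\<psi>s \<in> set (subseqs \<phi>s)"
    then have "e (BPlus (big_conj \<psi>s)) = b (\<Inter>(set (map sem \<psi>s)))" if "\<psi>s \<noteq> []"
      using that sub[of \<psi>s] b_sem[of "big_conj \<psi>s"] sem_big_conj[of \<psi>s] by (simp add: relevant_def)
    then show "(if \<psi>s = [] then 0 else (- 1) ^ length \<psi>s * e (BPlus (big_conj \<psi>s))) =
        (if \<psi>s = [] then 0 else (- 1) ^ length \<psi>s * b (\<Inter>(set (map sem \<psi>s))))"
      by simp
  qed
  also have "\<dots> = (\<Sum>zs\<leftarrow>subseqs (map sem \<phi>s). if zs = [] then 0
      else (- 1) ^ length zs * b (\<Inter>(set zs)))"
    by (simp add: subseqs_map comp_def cong: if_cong)
  also have "\<dots> = alt_sum b xs UNIV - b UNIV"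
    unfolding xs by (rule alt_sum_nonempty)
  finally have sum: "(\<Sum>\<psi>s\<leftarrow>subseqs \<phi>s. if \<psi>s = [] then 0
      else (- 1) ^ length \<psi>s * e (BPlus (big_conj \<psi>s))) = alt_sum b xs UNIV - b UNIV" .
  have "bval (ineq_holds e) (Prim (Ge ((1, BPlus (big_disj \<phi>s)) #
        [((-1) ^ length \<psi>s, BPlus (big_conj \<psi>s)). \<psi>s \<leftarrow> subseqs \<phi>s, \<psi>s \<noteq> []]) 0))"
    by (rule hold) (use \<phi>s in \<open>auto simp: axioms_def\<close>)
  moreover have "(\<Sum>(n, t)\<leftarrow>[((- 1) ^ length \<psi>s, BPlus (big_conj \<psi>s)). \<psi>s \<leftarrow> subseqs \<phi>s, \<psi>s \<noteq> []].
        real_of_int n * e t) =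
     (\<Sum>\<psi>s\<leftarrow>subseqs \<phi>s. if \<psi>s = [] then 0 else (- 1) ^ length \<psi>s * e (BPlus (big_conj \<psi>s)))"
    by (subst sum_list_concat_if) (auto intro!: arg_cong[where f = sum_list])
  moreover have "e (BPlus (big_disj \<phi>s)) = b (\<Union>(set xs))"
    using b_sem[of "big_disj \<phi>s"] \<phi>s sem_big_disj[of \<phi>s] assms(2)
    by (simp add: relevant_def xs[symmetric])
  ultimately show ?thesis
    using sum by simp
qed

lemma set_belief_b: "set_belief (range sem) b"
  unfolding set_belief_def
proof (intro conjI allI impI)
  show "\<forall>S\<in>range sem. 0 \<le> b S \<and> b S \<le> 1"
    by (auto simp: b_def rep_relevant nonneg le_1)
  show "\<forall>S\<in>range sem. \<forall>T\<in>range sem. S \<subseteq> T \<longrightarrow> b S \<le> b T"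
    unfolding b_def by (intro ballI impI mono rep_relevant) (simp_all add: sem_rep)
  fix k :: nat and a :: "nat \<Rightarrow> ('p set \<times> 'p set) set"
  assume k: "1 \<le> k" and a: "a ` {1..k} \<subseteq> range sem"
  define xs where "xs = map a [1..<Suc k]"
  have set_xs: "set xs = a ` {1..k}"
    unfolding xs_def by auto
  \<comment> \<open>The family may repeat sets while the chosen axioms cover distinct lists only;
    \<open>remdups\<close> changes neither \<open>alt_sum\<close> nor the union.\<close>
  have "b UNIV - alt_sum b (remdups xs) UNIV \<le> b (\<Union>(set (remdups xs)))"
  proof (rule alt_sum_bound_distinct)
    show "remdups xs \<noteq> []" using k by (simp add: xs_def)
  qed (use a in \<open>simp_all add: set_xs\<close>)
  then have bound: "b UNIV - alt_sum b xs UNIV \<le> b (\<Union>(a ` {1..k}))"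
    by (simp add: alt_sum_remdups set_xs)
  define f where "f n X = (if X = {} then 0 else (- 1) ^ n * b (\<Inter>X))"
    for n :: nat and X :: "('p set \<times> 'p set) set set"
  have "alt_sum b xs UNIV - b UNIV = (\<Sum>zs\<leftarrow>subseqs xs. f (length zs) (set zs))"
    unfolding alt_sum_nonempty[symmetric] f_def by simp
  also have "\<dots> = (\<Sum>J | J \<subseteq> {1..k} \<and> J \<noteq> {}. f (card J) (a ` J))"
    unfolding xs_def by (rule sum_list_subseqs_map) (simp add: f_def)
  also have "\<dots> = - (\<Sum>J | J \<subseteq> {1..k} \<and> J \<noteq> {}. (- 1) ^ (card J + 1) * b (\<Inter>(a ` J)))"
    unfolding sum_negf[symmetric] by (rule sum.cong) (auto simp: f_def)
  finally show "(\<Sum>J | J \<subseteq> {1..k} \<and> J \<noteq> {}. (- 1) ^ (card J + 1) * b (\<Inter>(a ` J)))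
      \<le> b (\<Union>(a ` {1..k}))"
    using bound by linarith
qed

text \<open>The finite algebra of truth sets embeds into the infinite type \<open>'m\<close>. The
  negation condition forces \<open>bel2\<close> to be \<open>b\<close> after \<open>sem_neg\<close>;
  on \<open>\<Phi>\<close>, B2 identifies this with the value of \<open>BMinus\<close>.\<close>

lemma model_exists:
  obtains A :: "'m::infinite de_morgan" and v bel1 bel2
  where "belief_model A v bel1 bel2"
    and "\<And>\<phi>. \<phi> \<in> \<Phi> \<Longrightarrow> bel1 (v \<phi>) = e (BPlus \<phi>)"
    and "\<And>\<phi>. \<phi> \<in> \<Phi> \<Longrightarrow> bel2 (v \<phi>) = e (BMinus \<phi>)"
proof -
  obtain \<iota> :: "('p set \<times> 'p set) set \<Rightarrow> 'm" where \<iota>: "inj \<iota>"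
    using arb_inj_on_finite_infinite[of "UNIV :: ('p set \<times> 'p set) set set"] by auto
  interpret de_morgan_sets "range sem" sem_neg \<iota>
    by (rule de_morgan_sets_sem[OF \<iota>])
  have "belief_model alg (\<lambda>\<phi>. \<iota> (sem \<phi>)) (\<lambda>x. b (un\<iota> x)) (\<lambda>x. b (sem_neg (un\<iota> x)))"
  proof unfold_locales
    show "general_belief alg (\<lambda>x. b (un\<iota> x))"
      by (rule general_belief_alg[OF set_belief_b])
    show "general_belief (inv_gorder alg) (\<lambda>x. b (sem_neg (un\<iota> x)))"
      by (rule general_belief_inv_alg[OF set_belief_b])
    show "b (un\<iota> x) = b (sem_neg (un\<iota> (neg alg x)))" if "x \<in> carrier alg" for x
      using that by (auto simp: alg_simps un\<iota> ng_closed ng_ng)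
    show "b (sem_neg (un\<iota> x)) = b (un\<iota> (neg alg x))" if "x \<in> carrier alg" for x
      using that by (auto simp: alg_simps un\<iota> ng_closed)
  qed (simp_all add: alg_simps sem_Neg sem_Conj sem_Disj join_alg meet_alg)
  moreover have "b (un\<iota> (\<iota> (sem \<phi>))) = e (BPlus \<phi>)" if "\<phi> \<in> \<Phi>" for \<phi>
    using that by (simp add: un\<iota> b_sem relevant_def)
  moreover have "b (sem_neg (un\<iota> (\<iota> (sem \<phi>)))) = e (BMinus \<phi>)" if "\<phi> \<in> \<Phi>" for \<phi>
    using that by (simp add: un\<iota> sem_Neg[symmetric] b_sem relevant_def BMinus_eq)
  ultimately show thesis by (rule that)
qed

end

section \<open>Completeness\<close>

primrec bterm_arg :: "'p bterm \<Rightarrow> 'p bd" where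
  "bterm_arg (BPlus \<phi>) = \<phi>"
| "bterm_arg (BMinus \<phi>) = \<phi>"

definition arguments :: "'p belief_formula \<Rightarrow> 'p bd set" where
  "arguments \<alpha> = bterm_arg ` (\<Union>(set_ineq ` set_bform \<alpha>))"

lemma finite_arguments: "finite (arguments \<alpha>)"
proof -
  have "finite (set_ineq i)" for i :: "'b ineq"
    by (cases i) (auto simp: prod_set_simps)
  moreover have "finite (set_bform \<beta>)" for \<beta> :: "'b bform"
    by (induction \<beta>) auto
  ultimately show ?thesis
    by (simp add: arguments_def)
qed

lemma bval_cong: "(\<And>x. x \<in> set_bform \<alpha> \<Longrightarrow> I x \<longleftrightarrow> I' x) \<Longrightarrow> bval I \<alpha> \<longleftrightarrow> bval I' \<alpha>"
  by (induction \<alpha>) auto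

lemma ineq_holds_cong:
  assumes "\<And>x. x \<in> set_ineq i \<Longrightarrow> e x = e' x"
  shows "ineq_holds e i \<longleftrightarrow> ineq_holds e' i"
proof (cases i)
  case (Ge ts c)
  have "e x = e' x" if "(a, x) \<in> set ts" for a x
    by (rule assms) (use that in \<open>force simp: Ge prod_set_simps\<close>)
  then have "(\<Sum>(a, x)\<leftarrow>ts. real_of_int a * e x) = (\<Sum>(a, x)\<leftarrow>ts. real_of_int a * e' x)"
    by (intro arg_cong[where f = sum_list] map_cong) auto
  with Ge show ?thesis by simp
qed

text \<open>Every assignment satisfying the chosen axioms agrees with some model on the terms of
  \<open>\<alpha>\<close>, so validity makes \<open>\<alpha>\<close> a linear consequence of
  them.\<close>

lemma completeness:
  fixes \<alpha> :: "'p::finite belief_formula"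
  assumes "valid TYPE('m::infinite) \<alpha>"
  shows "bBD_derivable \<alpha>"
proof (rule derivable_if_linear_consequence)
  show "finite (axioms (arguments \<alpha>))"
    by (rule finite_axioms[OF finite_arguments])
  show "bBD_derivable \<gamma>" if "\<gamma> \<in> axioms (arguments \<alpha>)" for \<gamma>
    by (rule derivable_axioms[OF that])
  fix e assume "\<forall>\<gamma>\<in>axioms (arguments \<alpha>). bval (ineq_holds e) \<gamma>"
  then interpret axioms_hold "arguments \<alpha>" e
    by unfold_locales blast
  obtain A :: "'m de_morgan" and v bel1 bel2 where model: "belief_model A v bel1 bel2"
    and bel1: "\<And>\<phi>. \<phi> \<in> arguments \<alpha> \<Longrightarrow> bel1 (v \<phi>) = e (BPlus \<phi>)"
    and bel2: "\<And>\<phi>. \<phi> \<in> arguments \<alpha> \<Longrightarrow> bel2 (v \<phi>) = e (BMinus \<phi>)"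
    by (rule model_exists) (blast intro: that)
  have "bterm_value v bel1 bel2 t = e t" if "t \<in> set_ineq i" "i \<in> set_bform \<alpha>" for t i
  proof -
    have "bterm_arg t \<in> arguments \<alpha>"
      using that by (auto simp: arguments_def)
    then show ?thesis
      by (cases t) (simp_all add: bel1 bel2)
  qed
  then have "bval (ineq_holds (bterm_value v bel1 bel2)) \<alpha> \<longleftrightarrow> bval (ineq_holds e) \<alpha>"
    by (intro bval_cong ineq_holds_cong) auto
  moreover have "satisfies v bel1 bel2 \<alpha>"
    using assms model unfolding valid_def by blast
  ultimately show "bval (ineq_holds e) \<alpha>"
    by (simp add: satisfies_def)
qed

theorem mainTheorem4:
  fixes \<alpha> :: "'p::finite belief_formula"
  shows "bBD_derivable \<alpha> \<longleftrightarrow> valid TYPE('m :: infinite) \<alpha>"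
  using completeness belief_model.soundness unfolding valid_def by blast

end
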